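(* Let $\{a_n\}_{n=0}^\infty$ be the $f$-sequence associated with $3$-bin decompositions, i.e. with $f(n)=\max\{1,n\bmod 3\}$. Then $\{a_n\}$ satisfies no linear homogeneous recurrence relation with non-negative integer coefficients: there do not exist an integer $h\ge1$ and non-negative integers $d_1,\dots,d_h$ such that $a_n=\sum_{i=1}^h d_i a_{n-i}$ for all $n\ge h$.
   Context: $\mathbb{N}_0=\{0,1,2,\dots\}$. Given $f:\mathbb{N}_0\to\mathbb{N}_0$ and a sequence $\{a_n\}_{n=0}^\infty$, an $f$-decomposition of $x$ using $\{a_n\}$ is a finite sum $x=\sum_{i} a_{n_i}$ of terms with pairwise distinct indices $n_i\ge 0$, such that for every $a_{n_i}$ in the sum, the previous $f(n_i)$ terms $a_{n_i-f(n_i)},\dots,a_{n_i-1}$ (those with index $\ge 0$) are not in the sum. The $f$-sequence is the unique increasing sequence of positive integers such that every positive integer has a unique $f$-decomposition; explicitly $a_n=1$ for $n<1$ and $a_n=a_{n-1}+a_{n-1-f(n-1)}$ for $n\ge 1$. For $f(n)=\max\{1,n\bmod 3\}$ (values $1,1,2,1,1,2,\dots$) it begins $1,2,3,4,7,11,15,26,41,56,97,153,\dots$. *)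

theory Defs
  imports Main
begin

text \<open>A finite sum of terms with pairwise distinct indices is represented by its index set \<open>S\<close>.
  Truncated subtraction in \<open>{n - f n..<n}\<close> discards exactly the negative indices.\<close>

definition f_decomposition :: "(nat \<Rightarrow> nat) \<Rightarrow> (nat \<Rightarrow> nat) \<Rightarrow> nat set \<Rightarrow> nat \<Rightarrow> bool" where
  "f_decomposition f a S x \<longleftrightarrow>
     finite S \<and> x = (\<Sum>n\<in>S. a n) \<and> (\<forall>n\<in>S. {n - f n..<n} \<inter> S = {})"

definition f_sequence :: "(nat \<Rightarrow> nat) \<Rightarrow> (nat \<Rightarrow> nat) \<Rightarrow> bool" where
  "f_sequence f a \<longleftrightarrow>
     strict_mono a \<and> (\<forall>n. a n > 0) \<and> (\<forall>x>0. \<exists>!S. f_decomposition f a S x)"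

text \<open>The explicit recursion \<open>a n = a (n - 1) + a (n - 1 - f (n - 1))\<close>, with \<open>a k = 1\<close> for
  \<open>k < 1\<close>. Truncated subtraction sends all negative indices to \<open>0\<close>, where the value is
  \<open>1\<close> as well.\<close>

fun f_seq :: "(nat \<Rightarrow> nat) \<Rightarrow> nat \<Rightarrow> nat" where
  "f_seq f 0 = 1"
| "f_seq f (Suc n) = f_seq f n + f_seq f (n - f n)"

lemma f_seq_pos: "f_seq f n > 0"
  by (induction n) auto

lemma strict_mono_f_seq: "strict_mono (f_seq f)"
  by (simp add: strict_mono_Suc_iff f_seq_pos)

lemma f_decomposition_empty_iff:
  assumes "\<And>n. a n > 0"
  shows "f_decomposition f a S 0 \<longleftrightarrow> S = {}"
  by (auto simp: f_decomposition_def gr_implies_not0[OF assms])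

lemma f_decomposition_insert:
  assumes "f_decomposition f a T y" "T \<subseteq> {..<n - f n}"
  shows "f_decomposition f a (insert n T) (a n + y)"
proof -
  have T: "finite T" "y = sum a T" "\<And>m. m \<in> T \<Longrightarrow> {m - f m..<m} \<inter> T = {}"
    using assms(1) unfolding f_decomposition_def by blast+
  have less: "m < n - f n" if "m \<in> T" for m
    using that assms(2) by blast
  have "n \<notin> T" using less by fastforce
  then have "a n + y = sum a (insert n T)" using T(1,2) by simp
  moreover have "{m - f m..<m} \<inter> insert n T = {}" if m: "m \<in> insert n T" for m
  proof (cases "m = n")
    case True
    have "k \<notin> insert n T" if "k \<in> {n - f n..<n}" for k
      using that less[of k] by fastforce
    then show ?thesis using True by blast
  next
    case False
    then have "m \<in> T" using m by blast
    moreover have "n \<notin> {m - f m..<m}" using less[OF \<open>m \<in> T\<close>] by auto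
    ultimately show ?thesis using T(3)[of m] by blast
  qed
  ultimately show ?thesis using T(1) unfolding f_decomposition_def by blast
qed

lemma f_decomposition_remove:
  assumes "f_decomposition f a S x" "n \<in> S" "S \<subseteq> {..n}"
  shows "f_decomposition f a (S - {n}) (x - a n)" "S - {n} \<subseteq> {..<n - f n}" "x \<ge> a n"
proof -
  have S: "finite S" "x = sum a S" "\<And>m. m \<in> S \<Longrightarrow> {m - f m..<m} \<inter> S = {}"
    using assms(1) unfolding f_decomposition_def by blast+
  have x: "x = a n + sum a (S - {n})"
    using S(2) sum.remove[OF S(1) assms(2), of a] by simp
  then show "x \<ge> a n" by simp
  have "finite (S - {n})" "x - a n = sum a (S - {n})"
    using S(1) x by simp_all
  moreover have "\<forall>m\<in>S - {n}. {m - f m..<m} \<inter> (S - {n}) = {}"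
    using S(3) by blast
  ultimately show "f_decomposition f a (S - {n}) (x - a n)"
    unfolding f_decomposition_def by blast
  show "S - {n} \<subseteq> {..<n - f n}"
  proof
    fix m assume m: "m \<in> S - {n}"
    then have "m \<notin> {n - f n..<n}" using S(3)[OF assms(2)] by blast
    moreover have "m \<noteq> n" "m \<le> n" using m assms(3) by auto
    ultimately show "m \<in> {..<n - f n}" by simp
  qed
qed

lemma f_seq_decomposition_less:
  assumes "f_decomposition f (f_seq f) S x" "S \<subseteq> {..<n}"
  shows "x < f_seq f n"
  using assms
proof (induction n arbitrary: S x rule: less_induct)
  case (less n)
  show ?case
  proof (cases n)
    case 0
    then show ?thesis using less.prems by (auto simp: f_decomposition_def)
  next
    case (Suc m)
    show ?thesis
    proof (cases "m \<in> S")
      case False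
      then have "S \<subseteq> {..<m}" using less.prems(2) Suc by (auto simp: less_Suc_eq)
      then show ?thesis using less.IH[of m S x] less.prems(1) Suc by simp
    next
      case True
      moreover have "S \<subseteq> {..m}" using less.prems(2) Suc by auto
      ultimately have "x - f_seq f m < f_seq f (m - f m)"
        using f_decomposition_remove[OF less.prems(1)] less.IH[of "m - f m"] Suc
        by (meson diff_le_self le_imp_less_Suc)
      then show ?thesis using Suc by simp
    qed
  qed
qed

lemma f_seq_decomposition_ex1:
  assumes "x < f_seq f n"
  shows "\<exists>!S. f_decomposition f (f_seq f) S x \<and> S \<subseteq> {..<n}"
  using assms
proof (induction n arbitrary: x rule: less_induct)
  case (less n)
  show ?case
  proof (cases n)
    case 0
    then show ?thesis using less.prems
      by (auto simp: f_decomposition_empty_iff[OF f_seq_pos])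
  next
    case (Suc m)
    show ?thesis
    proof (cases "x < f_seq f m")
      case True
      have "f_decomposition f (f_seq f) S x \<and> S \<subseteq> {..<n} \<longleftrightarrow>
          f_decomposition f (f_seq f) S x \<and> S \<subseteq> {..<m}" for S
      proof (intro iffI conjI; elim conjE)
        assume S: "f_decomposition f (f_seq f) S x" "S \<subseteq> {..<n}"
        then have le: "S \<subseteq> {..m}" using Suc by auto
        then have "m \<notin> S" using f_decomposition_remove(3)[OF S(1) _ le] True by auto
        then show "S \<subseteq> {..<m}" using le by (auto simp: le_less)
      next
        assume "S \<subseteq> {..<m}"
        then show "S \<subseteq> {..<n}" using Suc by auto
      qed
      moreover have "\<exists>!S. f_decomposition f (f_seq f) S x \<and> S \<subseteq> {..<m}"
        by (rule less.IH) (use True Suc in simp_all)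
      ultimately show ?thesis by (simp only:)
    next
      case False
      define y where "y = x - f_seq f m"
      have x: "x = f_seq f m + y" using False by (simp add: y_def)
      have "y < f_seq f (m - f m)" using less.prems x Suc by simp
      then have "\<exists>!T. f_decomposition f (f_seq f) T y \<and> T \<subseteq> {..<m - f m}"
        using less.IH[of "m - f m" y] Suc by simp
      then obtain T where T: "f_decomposition f (f_seq f) T y" "T \<subseteq> {..<m - f m}"
        and uniq: "\<And>T'. f_decomposition f (f_seq f) T' y \<Longrightarrow> T' \<subseteq> {..<m - f m} \<Longrightarrow> T' = T"
        by blast
      show ?thesis
      proof (rule ex1I[of _ "insert m T"])
        show "f_decomposition f (f_seq f) (insert m T) x \<and> insert m T \<subseteq> {..<n}"
          using f_decomposition_insert[OF T] T(2) x Suc by (auto simp: subset_iff)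
      next
        fix S assume S: "f_decomposition f (f_seq f) S x \<and> S \<subseteq> {..<n}"
        then have le: "S \<subseteq> {..m}" using Suc by auto
        have "m \<in> S"
        proof (rule ccontr)
          assume "m \<notin> S"
          then have "S \<subseteq> {..<m}" using le by (auto simp: le_less)
          then show False using f_seq_decomposition_less S False by blast
        qed
        then have "S - {m} = T"
          using uniq f_decomposition_remove(1,2)[of f "f_seq f" S x m] S le by (simp add: y_def)
        then show "S = insert m T" using \<open>m \<in> S\<close> by auto
      qed
    qed
  qed
qed

lemma f_sequence_f_seq: "f_sequence f (f_seq f)"
  unfolding f_sequence_def
proof (intro conjI allI impI strict_mono_f_seq f_seq_pos)
  fix x :: nat
  have lt: "x < f_seq f (Suc x)"
    using strict_mono_imp_increasing[OF strict_mono_f_seq, of "Suc x" f] by simp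
  have "\<exists>!S. f_decomposition f (f_seq f) S x \<and> S \<subseteq> {..<Suc x}"
    by (rule f_seq_decomposition_ex1[OF lt])
  moreover have "S \<subseteq> {..<Suc x}" if S: "f_decomposition f (f_seq f) S x" for S
  proof
    fix k assume "k \<in> S"
    then have "f_seq f k \<le> x" using S by (auto simp: f_decomposition_def intro: member_le_sum)
    then have "f_seq f k < f_seq f (Suc x)" using lt by simp
    then show "k \<in> {..<Suc x}" by (simp only: strict_mono_less[OF strict_mono_f_seq] lessThan_iff)
  qed
  ultimately show "\<exists>!S. f_decomposition f (f_seq f) S x" by blast
qed

lemma f_decomposition_cong:
  assumes "\<And>n. n \<in> S \<Longrightarrow> a n = b n"
  shows "f_decomposition f a S x \<longleftrightarrow> f_decomposition f b S x"
  using assms by (simp add: f_decomposition_def cong: sum.cong)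

theorem f_sequence_iff: "f_sequence f a \<longleftrightarrow> a = f_seq f"
proof
  assume a: "f_sequence f a"
  have "a n = f_seq f n" for n
  proof (induction n rule: less_induct)
    case (less n)
    have cong: "f_decomposition f a S x \<longleftrightarrow> f_decomposition f (f_seq f) S x"
      if "S \<subseteq> {..<n}" for S x
      using that less by (intro f_decomposition_cong) auto
    have single: "f_decomposition f a {n} (a n)" by (auto simp: f_decomposition_def)
    show ?case
    proof (rule antisym)
      obtain S where S: "f_decomposition f a S (f_seq f n)"
        using a f_seq_pos unfolding f_sequence_def by blast
      then have "\<not> S \<subseteq> {..<n}"
        using cong f_seq_decomposition_less by blast
      then obtain k where k: "k \<in> S" "k \<ge> n" by force
      have "a n \<le> a k" using a k by (simp add: f_sequence_def strict_mono_less_eq)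
      also have "\<dots> \<le> f_seq f n"
        using S k by (auto simp: f_decomposition_def intro: member_le_sum)
      finally show "a n \<le> f_seq f n" .
    next
      show "f_seq f n \<le> a n"
      proof (rule ccontr)
        assume "\<not> f_seq f n \<le> a n"
        then obtain S where S: "f_decomposition f (f_seq f) S (a n)" "S \<subseteq> {..<n}"
          using f_seq_decomposition_ex1[of "a n" f n] by (meson not_le)
        then have "S = {n}" using a single cong unfolding f_sequence_def by blast
        then show False using S by auto
      qed
    qed
  qed
  then show "a = f_seq f" by auto
qed (simp add: f_sequence_f_seq)

end

theory Submission
  imports Defs Complex_Main
begin

text \<open>
  The three subsequences \<open>a (3 * k + r)\<close> all satisfy \<open>x (k + 2) = 4 * x (k + 1) - x k\<close>, whose
  characteristic roots are \<open>2 + sqrt 3\<close> and \<open>2 - sqrt 3\<close>. A linear recurrence satisfied by \<open>a\<close> is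
  inherited by every fixed linear combination of shifts of \<open>a\<close>, in particular by one in which the
  dominant root has been cancelled, so that only multiples of \<open>(2 - sqrt 3) ^ k\<close> are left. For
  \<open>b n = a n + a (n + 1) + a (n + 2)\<close>, the combination \<open>T n = (2 + sqrt 3) * b n - b (n + 3)\<close> is
  of this kind: \<open>T (n + 3) = (2 - sqrt 3) * T n\<close>. It is moreover
  positive, since its first three values are (\<open>residual_pos\<close>).

  But a positive sequence that satisfies a recurrence with coefficients in the natural numbers
  cannot decay: some coefficient \<open>d i\<close> is at least 1, so \<open>T (n - i) \<le> T n\<close> for all large \<open>n\<close>, while
  \<open>T (n + 3) < T n\<close>; comparing \<open>T n\<close> with \<open>T (n + 3 * i)\<close> gives a contradiction
  (\<open>no_nat_recurrence_if_decaying\<close>).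
\<close>

text \<open>If the coefficient \<open>d i\<close> is nonzero, \<open>m\<close> jumps of length \<open>i\<close> do not decrease \<open>T\<close>, whereas
  \<open>i\<close> jumps of length \<open>m\<close>, leading to the same index, do decrease it.\<close>

lemma no_nat_recurrence_if_decaying:
  fixes T :: "nat \<Rightarrow> real" and d :: "nat \<Rightarrow> nat"
  assumes pos: "\<And>n. T n > 0" and decay: "\<And>n. T (n + m) < T n"
  shows "\<not> (\<forall>n\<ge>h. T n = (\<Sum>i=1..h. real (d i) * T (n - i)))"
proof
  assume rec: "\<forall>n\<ge>h. T n = (\<Sum>i=1..h. real (d i) * T (n - i))"
  have "(\<Sum>i=1..h. real (d i) * T (h - i)) \<noteq> 0"
    using rec pos[of h] by auto
  then obtain i where i: "i \<in> {1..h}" "d i \<noteq> 0"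
    by (metis (no_types, lifting) sum.neutral mult_eq_0_iff of_nat_0)
  have step: "T n \<le> T (n + i)" if "n \<ge> h" for n
  proof -
    have "T n \<le> real (d i) * T (n + i - i)"
      using i(2) pos[of n] by simp
    also have "\<dots> \<le> (\<Sum>j=1..h. real (d j) * T (n + i - j))"
      by (rule member_le_sum[OF i(1)]) (simp_all add: less_imp_le[OF pos])
    also have "\<dots> = T (n + i)"
      using rec that by simp
    finally show ?thesis .
  qed
  have up: "T h \<le> T (h + i * k)" for k
  proof (induction k)
    case (Suc k)
    then show ?case using step[of "h + i * k"] by (simp add: add_ac)
  qed simp
  have down: "T (h + m * Suc k) < T h" for k
  proof (induction k)
    case (Suc k)
    then show ?case using decay[of "h + m * Suc k"] by (simp add: add_ac)
  qed (use decay in simp)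
  have "Suc (i - 1) = i"
    using i(1) by simp
  then show False
    using up[of m] down[of "i - 1"] by (simp add: mult.commute)
qed

definition bin3_seq :: "nat \<Rightarrow> nat" where
  "bin3_seq = f_seq (\<lambda>n. max 1 (n mod 3))"

lemma bin3_seq_steps:
  "bin3_seq (3 * k + 2) = bin3_seq (3 * k + 1) + bin3_seq (3 * k)"
  "bin3_seq (3 * k + 3) = bin3_seq (3 * k + 2) + bin3_seq (3 * k)"
  "bin3_seq (3 * k + 4) = bin3_seq (3 * k + 3) + bin3_seq (3 * k + 2)"
proof -
  have mods: "(3 * k + 1) mod 3 = 1" "(3 * k + 2) mod 3 = 2" "(3 * k + 3) mod 3 = 0"
    by presburger+
  have shifts: "3 * k + 2 = Suc (3 * k + 1)" "3 * k + 3 = Suc (3 * k + 2)"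
    "3 * k + 4 = Suc (3 * k + 3)"
    by simp_all
  have gaps: "3 * k + 1 - max 1 1 = 3 * k" "3 * k + 2 - max 1 2 = 3 * k"
    "3 * k + 3 - max 1 0 = 3 * k + 2"
    by simp_all
  show "bin3_seq (3 * k + 2) = bin3_seq (3 * k + 1) + bin3_seq (3 * k)"
    unfolding bin3_seq_def
    by (subst shifts(1), subst f_seq.simps(2), subst mods(1), subst gaps(1), rule refl)
  show "bin3_seq (3 * k + 3) = bin3_seq (3 * k + 2) + bin3_seq (3 * k)"
    unfolding bin3_seq_def
    by (subst shifts(2), subst f_seq.simps(2), subst mods(2), subst gaps(2), rule refl)
  show "bin3_seq (3 * k + 4) = bin3_seq (3 * k + 3) + bin3_seq (3 * k + 2)"
    unfolding bin3_seq_def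
    by (subst shifts(3), subst f_seq.simps(2), subst mods(3), subst gaps(3), rule refl)
qed

text \<open>By the one-step rules, the terms with indices \<open>3 * k\<close> to \<open>3 * k + 8\<close> are linear combinations
  of \<open>bin3_seq (3 * k)\<close> and \<open>bin3_seq (3 * k + 1)\<close>.\<close>

lemma bin3_seq_recurrence: "bin3_seq (n + 6) + bin3_seq n = 4 * bin3_seq (n + 3)"
proof -
  define k where "k = n div 3"
  have s0: "bin3_seq (3 * k + 2) = bin3_seq (3 * k + 1) + bin3_seq (3 * k)"
    "bin3_seq (3 * k + 3) = bin3_seq (3 * k + 2) + bin3_seq (3 * k)"
    "bin3_seq (3 * k + 4) = bin3_seq (3 * k + 3) + bin3_seq (3 * k + 2)"
    by (rule bin3_seq_steps)+
  have next3: "3 * (k + 1) = 3 * k + 3" "3 * k + 3 + 1 = 3 * k + 4" "3 * k + 3 + 2 = 3 * k + 5"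
    "3 * k + 3 + 3 = 3 * k + 6" "3 * k + 3 + 4 = 3 * k + 7"
    by simp_all
  have s1: "bin3_seq (3 * k + 5) = bin3_seq (3 * k + 4) + bin3_seq (3 * k + 3)"
    "bin3_seq (3 * k + 6) = bin3_seq (3 * k + 5) + bin3_seq (3 * k + 3)"
    "bin3_seq (3 * k + 7) = bin3_seq (3 * k + 6) + bin3_seq (3 * k + 5)"
    using bin3_seq_steps[of "k + 1"] by (simp_all only: next3)
  have next6: "3 * (k + 2) = 3 * k + 6" "3 * k + 6 + 1 = 3 * k + 7" "3 * k + 6 + 2 = 3 * k + 8"
    by simp_all
  have s2: "bin3_seq (3 * k + 8) = bin3_seq (3 * k + 7) + bin3_seq (3 * k + 6)"
    using bin3_seq_steps(1)[of "k + 2"] by (simp only: next6)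
  have "n = 3 * k \<or> n = 3 * k + 1 \<or> n = 3 * k + 2"
    unfolding k_def by presburger
  then consider "n = 3 * k" | "n = 3 * k + 1" | "n = 3 * k + 2"
    by blast
  then show ?thesis
  proof cases
    case 1
    show ?thesis unfolding 1 using s0 s1 by linarith
  next
    case 2
    then have idx: "n + 3 = 3 * k + 4" "n + 6 = 3 * k + 7" by simp_all
    show ?thesis unfolding idx unfolding 2 using s0 s1 by linarith
  next
    case 3
    then have idx: "n + 3 = 3 * k + 5" "n + 6 = 3 * k + 8" by simp_all
    show ?thesis unfolding idx unfolding 3 using s0 s1 s2 by linarith
  qed
qed

lemma bin3_seq_init:
  "bin3_seq 0 = 1" "bin3_seq (Suc 0) = 2" "bin3_seq 2 = 3" "bin3_seq 3 = 4" "bin3_seq 4 = 7"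
  "bin3_seq 5 = 11" "bin3_seq 6 = 15" "bin3_seq 7 = 26"
proof -
  show 0: "bin3_seq 0 = 1" "bin3_seq (Suc 0) = 2"
    by (simp_all add: bin3_seq_def)
  show 1: "bin3_seq 2 = 3" "bin3_seq 3 = 4" "bin3_seq 4 = 7"
    using bin3_seq_steps[of 0] 0 by (simp_all flip: numeral_2_eq_2 numeral_3_eq_3)
  show "bin3_seq 5 = 11" "bin3_seq 6 = 15" "bin3_seq 7 = 26"
    using bin3_seq_steps[of 1] 1 by (simp_all flip: numeral_2_eq_2 numeral_3_eq_3)
qed

definition window_sum :: "nat \<Rightarrow> real" where
  "window_sum n = real (bin3_seq n) + real (bin3_seq (n + 1)) + real (bin3_seq (n + 2))"

text \<open>The residual of the dominant behaviour \<open>x (n + 3) = (2 + sqrt 3) * x n\<close>. Without the sum over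
  three consecutive terms its sign would depend on \<open>n mod 3\<close>.\<close>

definition residual :: "nat \<Rightarrow> real" where
  "residual n = (2 + sqrt 3) * window_sum n - window_sum (n + 3)"

lemma residual_add_3: "residual (n + 3) = (2 - sqrt 3) * residual n"
proof -
  have rec: "real (bin3_seq (j + 6)) = 4 * real (bin3_seq (j + 3)) - real (bin3_seq j)" for j
    using arg_cong[OF bin3_seq_recurrence[of j], of real] by simp
  have W: "window_sum (n + 3 + 3) = 4 * window_sum (n + 3) - window_sum n"
    using rec[of n] rec[of "n + 1"] rec[of "n + 2"]
    by (simp add: window_sum_def algebra_simps)
  have "residual (n + 3) = window_sum n - (2 - sqrt 3) * window_sum (n + 3)"
    unfolding residual_def W by (simp add: algebra_simps)
  also have "\<dots> = (2 - sqrt 3) * residual n"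
    unfolding residual_def by (simp add: algebra_simps)
  finally show ?thesis .
qed

lemma sqrt_3_bounds: "12 / 7 < sqrt 3" "sqrt 3 < 2"
  by (rule real_less_rsqrt, simp add: power2_eq_square)
    (rule real_less_lsqrt, simp_all)

lemma residual_pos: "residual n > 0"
proof (induction n rule: less_induct)
  case (less n)
  show ?case
  proof (cases "n < 3")
    case True
    \<comment> \<open>The first window sums are 6, 9, 14, 22, 33, 52. The third residual requires the sharpest
      bound on \<open>sqrt 3\<close>, namely 12 / 7.\<close>
    have "residual 0 = 6 * sqrt 3 - 10" "residual 1 = 9 * sqrt 3 - 15"
      "residual 2 = 14 * sqrt 3 - 24"
      using bin3_seq_init by (simp_all add: residual_def window_sum_def algebra_simps
          flip: numeral_2_eq_2 numeral_3_eq_3)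
    moreover have "n = 0 \<or> n = 1 \<or> n = 2"
      using True by auto
    ultimately show ?thesis
      using sqrt_3_bounds by auto
  next
    case False
    then show ?thesis
      using less.IH[of "n - 3"] residual_add_3[of "n - 3"] sqrt_3_bounds by simp
  qed
qed

theorem propositionB2:
  fixes a :: "nat \<Rightarrow> nat"
  assumes "f_sequence (\<lambda>n. max 1 (n mod 3)) a"
  shows "\<not> (\<exists>h\<ge>1. \<exists>d :: nat \<Rightarrow> nat. \<forall>n\<ge>h. a n = (\<Sum>i=1..h. d i * a (n - i)))"
proof
  assume "\<exists>h\<ge>1. \<exists>d :: nat \<Rightarrow> nat. \<forall>n\<ge>h. a n = (\<Sum>i=1..h. d i * a (n - i))"
  then obtain h and d :: "nat \<Rightarrow> nat"
    where rec: "\<And>n. n \<ge> h \<Longrightarrow> bin3_seq n = (\<Sum>i=1..h. d i * bin3_seq (n - i))"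
    using assms unfolding f_sequence_iff bin3_seq_def by blast
  have shift: "real (bin3_seq (n + j)) = (\<Sum>i=1..h. real (d i) * real (bin3_seq (n - i + j)))"
    if "n \<ge> h" for n j
  proof -
    have "real (bin3_seq (n + j)) = (\<Sum>i=1..h. real (d i) * real (bin3_seq (n + j - i)))"
      using that by (subst rec) simp_all
    also have "\<dots> = (\<Sum>i=1..h. real (d i) * real (bin3_seq (n - i + j)))"
      using that by (intro sum.cong) auto
    finally show ?thesis .
  qed
  have window: "window_sum (n + j) = (\<Sum>i=1..h. real (d i) * window_sum (n - i + j))"
    if "n \<ge> h" for n j
    using shift[OF that, of j] shift[OF that, of "j + 1"] shift[OF that, of "j + 2"]
    by (simp add: window_sum_def sum.distrib distrib_left add.assoc)
  have "residual n = (\<Sum>i=1..h. real (d i) * residual (n - i))" if "n \<ge> h" for n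
    using window[OF that, of 0] window[OF that, of 3]
    by (simp add: residual_def sum_subtractf sum_distrib_left right_diff_distrib mult.left_commute)
  moreover have "residual (n + 3) < residual n" for n
    using residual_pos[of n] sqrt_3_bounds by (simp add: residual_add_3)
  ultimately show False
    using no_nat_recurrence_if_decaying[of residual 3 h d] residual_pos by blast
qed

end
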